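(* Let $f\in C^2(\mathbb R^n,\mathbb R)$ be strictly convex with $\nabla^2 f(x)\succ 0$ for all $x\in\mathbb R^n$, and suppose that $f$ attains its minimum value, at $x^\star\in\mathbb R^n$ (necessarily unique). Let $c_1,c_2>0$, $p_1>2$, $1<p_2<2$. Then the trajectories of $$\dot x=-(\nabla^2 f(x))^{-1}\left(c_1\frac{\nabla f(x)}{\|\nabla f(x)\|^{\frac{p_1-2}{p_1-1}}}+c_2\frac{\nabla f(x)}{\|\nabla f(x)\|^{\frac{p_2-2}{p_2-1}}}\right)$$ converge to the optimal point $x^\star$ in a fixed time $T_{NM}$ for any initial condition $x(0)\in\mathbb R^n$; that is, there exists $T_{NM}<\infty$, independent of $x(0)$, such that every trajectory satisfies $x(t)=x^\star$ for all $t\ge T_{NM}$.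
   Context: $\|\cdot\|$ is the Euclidean norm; $\nabla f$ and $\nabla^2 f$ are the gradient and Hessian. $A\succ 0$ means that $A$ is positive definite. Convention: the right-hand side of the differential equation is defined to be $0$ at points where $\nabla f(x)=0$. A trajectory is a solution $t\mapsto x(t)$, $t\ge 0$, of the differential equation. *)

theory Defs
  imports "HOL-Analysis.Analysis"
begin

definition gradient :: "('a::euclidean_space \<Rightarrow> real) \<Rightarrow> 'a \<Rightarrow> 'a" where
  "gradient f x = (THE D. GDERIV f x :> D)"

lemma gderiv_imp_gradient:
  assumes "GDERIV f x :> D"
  shows "gradient f x = D"
  unfolding gradient_def
proof (rule the_equality)
  fix D' assume "GDERIV f x :> D'"
  with assms have "(\<lambda>h. h \<bullet> D') = (\<lambda>h. h \<bullet> D)"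
    unfolding gderiv_def by (rule has_derivative_unique[rotated])
  then show "D' = D"
    by (metis vector_eq_rdot inner_commute)
qed (fact assms)

lemma differentiable_gderiv_gradient:
  assumes "f differentiable (at x)"
  shows "GDERIV f x :> gradient f x"
proof -
  obtain L where L: "(f has_derivative L) (at x)"
    using assms by (auto simp: differentiable_def)
  have "linear L"
    using L by (rule has_derivative_linear)
  then have "L = (\<lambda>h. h \<bullet> adjoint L 1)"
    using adjoint_works[of L _ 1] by (simp add: fun_eq_iff)
  with L have "GDERIV f x :> adjoint L 1"
    unfolding gderiv_def by simp
  then show ?thesis
    using gderiv_imp_gradient by metis
qed

definition hessian :: "(real ^ 'n \<Rightarrow> real) \<Rightarrow> real ^ 'n \<Rightarrow> real ^ 'n ^ 'n" where
  "hessian f x = jacobian (gradient f) (at x)"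

definition C2 :: "(real ^ 'n \<Rightarrow> real) \<Rightarrow> bool" where
  "C2 f \<longleftrightarrow> (\<forall>x. f differentiable (at x)) \<and>
     (\<forall>x. gradient f differentiable (at x)) \<and> continuous_on UNIV (hessian f)"

definition positive_definite :: "real ^ 'n ^ 'n \<Rightarrow> bool" where
  "positive_definite A \<longleftrightarrow> transpose A = A \<and> (\<forall>v. v \<noteq> 0 \<longrightarrow> 0 < v \<bullet> (A *v v))"

definition strictly_convex :: "('a::real_vector \<Rightarrow> real) \<Rightarrow> bool" where
  "strictly_convex f \<longleftrightarrow>
     (\<forall>x y. \<forall>u. x \<noteq> y \<and> 0 < u \<and> u < 1 \<longrightarrow>
        f ((1 - u) *\<^sub>R x + u *\<^sub>R y) < (1 - u) * f x + u * f y)"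

definition newton_field ::
    "(real ^ 'n \<Rightarrow> real) \<Rightarrow> real \<Rightarrow> real \<Rightarrow> real \<Rightarrow> real \<Rightarrow> real ^ 'n \<Rightarrow> real ^ 'n" where
  "newton_field f c1 c2 p1 p2 x =
     (if gradient f x = 0 then 0
      else - (matrix_inv (hessian f x) *v
        (c1 *\<^sub>R (gradient f x /\<^sub>R norm (gradient f x) powr ((p1 - 2) / (p1 - 1))) +
         c2 *\<^sub>R (gradient f x /\<^sub>R norm (gradient f x) powr ((p2 - 2) / (p2 - 1))))))"

(* Only the values x t with t \<ge> 0 matter; at t = 0 the derivative is one-sided. *)
definition trajectory :: "('a::real_normed_vector \<Rightarrow> 'a) \<Rightarrow> (real \<Rightarrow> 'a) \<Rightarrow> bool" where
  "trajectory F x \<longleftrightarrow> (\<forall>t\<ge>0. (x has_vector_derivative F (x t)) (at t within {0..}))"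

end

theory Submission
  imports Defs
begin

text \<open>
  Along a trajectory \<open>x\<close> the gradient \<open>g t = gradient f (x t)\<close> obeys an equation in which the
  Hessian has disappeared: by the chain rule \<open>g' = hessian f (x t) *v x'\<close>, and the Newton field
  carries the inverse Hessian as a factor.  Taking the inner product with \<open>g / norm g\<close> gives, as
  long as \<open>g \<noteq> 0\<close>, the scalar equation
  \<open>N' = - (c1 * N powr (1/(p1-1)) + c2 * N powr (1/(p2-1)))\<close> for \<open>N = norm g\<close>.  The first
  exponent lies strictly between 0 and 1, the second exceeds 1.

  The superlinear term brings \<open>N\<close> below 1 after a time that does not depend on \<open>N 0\<close>, because
  \<open>N powr (1 - \<delta>)\<close> with \<open>\<delta> > 1\<close> starts above 0 and grows at least linearly.  The sublinear term
  then brings \<open>N\<close> from 1 to 0 in a further bounded time, because \<open>N powr (1 - \<gamma>)\<close> with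
  \<open>\<gamma> < 1\<close> decreases at least linearly.  So \<open>N\<close> cannot stay positive beyond the sum of the two
  times (\<open>fixed_time_bound\<close>), and it cannot return to positive values, because it never increases
  (\<open>norm_gradient_antimono\<close>).

  Finally, a vanishing gradient identifies \<open>xstar\<close>: the gradient vanishes at a minimizer, and
  it is injective when the Hessian is positive definite (\<open>gradient_inj\<close>).
\<close>

section \<open>A scalar differential inequality\<close>

text \<open>
  The substitution \<open>M = N powr (1 - \<gamma>) / (1 - \<gamma>)\<close> linearizes \<open>N' \<le> - c * N powr \<gamma>\<close>
  to \<open>M' \<le> - c\<close>.  Keeping the divisor \<open>1 - \<gamma>\<close>, whose sign is not fixed, makes one statement
  cover both the sublinear and the superlinear case.
\<close>

lemma powr_decay:
  fixes N D :: "real \<Rightarrow> real"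
  assumes "a \<le> b" and "\<gamma> \<noteq> 1"
    and pos: "\<And>t. t \<in> {a..b} \<Longrightarrow> 0 < N t"
    and deriv: "\<And>t. t \<in> {a..b} \<Longrightarrow> (N has_real_derivative D t) (at t within {a..b})"
    and bound: "\<And>t. t \<in> {a..b} \<Longrightarrow> D t \<le> - c * N t powr \<gamma>"
  shows "N b powr (1 - \<gamma>) / (1 - \<gamma>) \<le> N a powr (1 - \<gamma>) / (1 - \<gamma>) - c * (b - a)"
proof -
  define M where "M = (\<lambda>t. N t powr (1 - \<gamma>) / (1 - \<gamma>))"
  have M': "(M has_real_derivative N t powr (- \<gamma>) * D t) (at t within {a..b})"
    if t: "t \<in> {a..b}" for t
  proof -
    have "((\<lambda>t. N t powr (1 - \<gamma>)) has_real_derivative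
        (1 - \<gamma>) * N t powr (1 - \<gamma> - 1) * D t) (at t within {a..b})"
      by (rule DERIV_chain2[OF has_real_derivative_powr[OF pos[OF t]] deriv[OF t]])
    from DERIV_cdivide[OF this, of "1 - \<gamma>"] show ?thesis
      unfolding M_def using \<open>\<gamma> \<noteq> 1\<close> by simp
  qed
  obtain s where s: "s \<in> {a..b}" and eq: "M b - M a = N s powr (- \<gamma>) * D s * (b - a)"
    using mvt_very_simple[OF \<open>a \<le> b\<close>, of M "\<lambda>t h. N t powr (- \<gamma>) * D t * h"] M'
    by (auto simp: has_field_derivative_def)
  have "N s powr (- \<gamma>) * D s \<le> N s powr (- \<gamma>) * (- c * N s powr \<gamma>)"
    using bound[OF s] by (intro mult_left_mono) auto
  also have "\<dots> = - c"
    using pos[OF s] by (simp add: powr_minus)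
  finally have "M b - M a \<le> - c * (b - a)"
    unfolding eq using \<open>a \<le> b\<close> by (intro mult_right_mono) auto
  then show ?thesis
    by (simp add: M_def)
qed

text \<open>
  The two summands of the bound are the time in which the superlinear term alone brings any
  positive start below 1, and the time in which the sublinear term alone brings 1 to 0.
\<close>

lemma fixed_time_bound:
  fixes N D :: "real \<Rightarrow> real"
  assumes c: "0 < c1" "0 < c2" and exps: "\<gamma> < 1" "1 < \<delta>"
    and pos: "\<And>t. t \<in> {0..b} \<Longrightarrow> 0 < N t"
    and deriv: "\<And>t. t \<in> {0..b} \<Longrightarrow> (N has_real_derivative D t) (at t within {0..b})"
    and bound: "\<And>t. t \<in> {0..b} \<Longrightarrow> D t \<le> - (c1 * N t powr \<gamma> + c2 * N t powr \<delta>)"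
  shows "b < 1 / (c2 * (\<delta> - 1)) + 1 / (c1 * (1 - \<gamma>))"
proof (rule ccontr)
  define T1 T2 where "T1 = 1 / (c2 * (\<delta> - 1))" and "T2 = 1 / (c1 * (1 - \<gamma>))"
  assume "\<not> ?thesis"
  then have b: "T1 + T2 \<le> b"
    by (simp add: T1_def T2_def)
  have T: "0 < T1" "0 < T2"
    using c exps by (simp_all add: T1_def T2_def)
  have bounds: "D t \<le> - c1 * N t powr \<gamma>" "D t \<le> - c2 * N t powr \<delta>" if "t \<in> {0..b}" for t
    using bound[OF that] c by (auto intro: order_trans)
  have "N T1 powr (1 - \<delta>) / (1 - \<delta>) \<le> N 0 powr (1 - \<delta>) / (1 - \<delta>) - c2 * (T1 - 0)"
    using T b exps bounds(2)
    by (intro powr_decay[where D = D] pos DERIV_subset[OF deriv]) auto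
  moreover have "N 0 powr (1 - \<delta>) / (1 - \<delta>) < 0"
    using pos[of 0] T b exps by (auto simp: divide_pos_neg)
  ultimately have "N T1 powr (1 - \<delta>) / (1 - \<delta>) < - c2 * T1"
    by simp
  also have "- c2 * T1 = 1 / (1 - \<delta>)"
    using c exps by (simp add: T1_def field_simps)
  finally have "1 < N T1 powr (1 - \<delta>)"
    using exps by (simp add: divide_less_cancel)
  \<comment> \<open>The exponent \<open>1 - \<delta>\<close> is negative, so this says that \<open>N\<close> has dropped below 1.\<close>
  then have "N T1 < 1"
    using exps powr_mono2'[of "1 - \<delta>" 1 "N T1"] by force
  then have "N T1 powr (1 - \<gamma>) < 1"
    using exps pos[of T1] T b powr_less_mono2[of "1 - \<gamma>" "N T1" 1] by simp
  have "N b powr (1 - \<gamma>) / (1 - \<gamma>) \<le> N T1 powr (1 - \<gamma>) / (1 - \<gamma>) - c1 * (b - T1)"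
    using T b exps bounds(1)
    by (intro powr_decay[where D = D] pos DERIV_subset[OF deriv]) auto
  also have "\<dots> < 1 / (1 - \<gamma>) - c1 * (b - T1)"
    using \<open>N T1 powr (1 - \<gamma>) < 1\<close> exps by (simp add: divide_strict_right_mono)
  also have "\<dots> \<le> 1 / (1 - \<gamma>) - c1 * T2"
    using c b by simp
  also have "\<dots> = 0"
    using c exps by (simp add: T2_def)
  finally have "N b powr (1 - \<gamma>) / (1 - \<gamma>) < 0" .
  then show False
    using exps by (simp add: divide_less_0_iff)
qed

section \<open>Gradient and Hessian\<close>

lemma gradient_has_derivative_hessian:
  assumes "C2 f"
  shows "(gradient f has_derivative (\<lambda>h. hessian f x *v h)) (at x)"
  using assms jacobian_works[of "gradient f" "at x"] by (simp add: C2_def hessian_def)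

text \<open>
  Between two points \<open>y\<close> and \<open>z\<close> with equal gradients, the mean value theorem for
  \<open>gradient f \<bullet> (z - y)\<close> along the segment yields a point at which the Hessian form vanishes
  on \<open>z - y\<close>.
\<close>

lemma gradient_inj:
  fixes f :: "real ^ 'n \<Rightarrow> real"
  assumes "C2 f" and pd: "\<And>x. positive_definite (hessian f x)"
    and "gradient f y = gradient f z"
  shows "y = z"
proof (rule ccontr)
  assume "y \<noteq> z"
  define v where "v = z - y"
  define \<phi> where "\<phi> = (\<lambda>s. gradient f (y + s *\<^sub>R v) \<bullet> v)"
  have "(\<phi> has_derivative (\<lambda>h. (hessian f (y + s *\<^sub>R v) *v (h *\<^sub>R v)) \<bullet> v)) (at s within {0..1})"
    for s
    unfolding \<phi>_def
    by (intro has_derivative_inner_left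
          has_derivative_compose[OF _ gradient_has_derivative_hessian[OF \<open>C2 f\<close>]])
       (auto intro!: derivative_eq_intros)
  then obtain s where
    "\<phi> 1 - \<phi> 0 = (hessian f (y + s *\<^sub>R v) *v ((1 - 0) *\<^sub>R v)) \<bullet> v"
    using mvt_very_simple[of 0 1 \<phi> "\<lambda>s h. (hessian f (y + s *\<^sub>R v) *v (h *\<^sub>R v)) \<bullet> v"]
    by auto
  moreover have "\<phi> 1 = \<phi> 0"
    using assms(3) by (simp add: \<phi>_def v_def)
  moreover have "0 < v \<bullet> (hessian f (y + s *\<^sub>R v) *v v)"
    using pd \<open>y \<noteq> z\<close> by (simp add: positive_definite_def v_def)
  ultimately show False
    by (simp add: inner_commute)
qed

lemma gradient_minimum:
  fixes f :: "real ^ 'n \<Rightarrow> real"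
  assumes "C2 f" and "\<And>y. f x \<le> f y"
  shows "gradient f x = 0"
proof -
  have "(f has_derivative (\<lambda>h. h \<bullet> gradient f x)) (at x)"
    using differentiable_gderiv_gradient[of f x] \<open>C2 f\<close> by (simp add: C2_def gderiv_def)
  then have "(\<lambda>h. h \<bullet> gradient f x) = (\<lambda>h. 0)"
    using assms(2) by (intro differential_zero_maxmin[of x UNIV f]) auto
  then show ?thesis
    by (metis inner_eq_zero_iff)
qed

lemma positive_definite_mult_inv:
  fixes A :: "real ^ 'n ^ 'n"
  assumes "positive_definite A"
  shows "A *v (matrix_inv A *v v) = v"
proof -
  have "\<forall>x. A *v x = 0 \<longrightarrow> x = 0"
    using assms unfolding positive_definite_def by (metis inner_zero_right less_irrefl)
  then have "invertible A"
    unfolding invertible_left_inverse matrix_left_invertible_ker .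
  then have "A ** matrix_inv A = mat 1"
    unfolding invertible_def matrix_inv_def by (rule someI2_ex) simp
  then show ?thesis
    by (simp add: matrix_vector_mul_assoc)
qed

section \<open>The gradient along a trajectory\<close>

text \<open>
  When \<open>g = 0\<close> the value is 0 as well, which agrees with the Newton field being 0 there; the
  equation for the gradient thus needs no case distinction.
\<close>

definition gradient_field :: "real \<Rightarrow> real \<Rightarrow> real \<Rightarrow> real \<Rightarrow> 'a::real_normed_vector \<Rightarrow> 'a" where
  "gradient_field c1 c2 p1 p2 g =
     - (c1 *\<^sub>R (g /\<^sub>R norm g powr ((p1 - 2) / (p1 - 1))) +
        c2 *\<^sub>R (g /\<^sub>R norm g powr ((p2 - 2) / (p2 - 1))))"

lemma hessian_mult_newton_field:
  fixes f :: "real ^ 'n \<Rightarrow> real"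
  assumes "positive_definite (hessian f x)"
  shows "hessian f x *v newton_field f c1 c2 p1 p2 x = gradient_field c1 c2 p1 p2 (gradient f x)"
  using positive_definite_mult_inv[OF assms]
  by (simp add: newton_field_def gradient_field_def
      linear_neg[OF matrix_vector_mul_linear])

lemma gradient_has_vector_derivative_along_trajectory:
  fixes f :: "real ^ 'n \<Rightarrow> real"
  assumes "C2 f" and "\<And>x. positive_definite (hessian f x)"
    and "trajectory (newton_field f c1 c2 p1 p2) x" and "0 \<le> t"
  shows "((\<lambda>t. gradient f (x t)) has_vector_derivative
           gradient_field c1 c2 p1 p2 (gradient f (x t))) (at t within {0..})"
proof -
  have "(x has_derivative (\<lambda>h. h *\<^sub>R newton_field f c1 c2 p1 p2 (x t))) (at t within {0..})"
    using assms(3,4) by (simp add: trajectory_def has_vector_derivative_def)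
  from has_derivative_compose[OF this gradient_has_derivative_hessian[OF \<open>C2 f\<close>]]
  show ?thesis
    by (simp add: has_vector_derivative_def matrix_vector_mult_scaleR
        hessian_mult_newton_field[OF assms(2)])
qed

lemma inner_gradient_field:
  fixes g :: "'a::real_inner"
  assumes "1 < p1" "1 < p2"
  shows "g \<bullet> gradient_field c1 c2 p1 p2 g =
    - norm g * (c1 * norm g powr (1 / (p1 - 1)) + c2 * norm g powr (1 / (p2 - 1)))"
proof -
  have *: "(norm g)\<^sup>2 / norm g powr ((p - 2) / (p - 1)) = norm g * norm g powr (1 / (p - 1))"
    if "1 < p" for p
  proof (cases "g = 0")
    case False
    have "1 / (p - 1) = 1 - (p - 2) / (p - 1)"
      using that by (simp add: field_simps)
    then show ?thesis
      using False by (simp add: powr_diff power2_eq_square)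
  qed simp
  show ?thesis
    using *[OF assms(1)] *[OF assms(2)]
    by (simp add: gradient_field_def inner_add_right power2_norm_eq_inner[symmetric] algebra_simps
        divide_inverse)
qed

text \<open>
  The square of the norm is differentiable even where the gradient vanishes, so monotonicity
  can be read off its derivative before it is known where the norm is positive.
\<close>

lemma norm_gradient_antimono:
  fixes f :: "real ^ 'n \<Rightarrow> real"
  assumes "C2 f" and "\<And>x. positive_definite (hessian f x)"
    and "trajectory (newton_field f c1 c2 p1 p2) x"
    and par: "0 < c1" "0 < c2" "1 < p1" "1 < p2"
    and "0 \<le> s" "s \<le> t"
  shows "norm (gradient f (x t)) \<le> norm (gradient f (x s))"
proof -
  define g where "g = (\<lambda>t. gradient f (x t))"
  have g': "(g has_derivative (\<lambda>h. h *\<^sub>R gradient_field c1 c2 p1 p2 (g r))) (at r within {s..t})"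
    if "r \<in> {s..t}" for r
    using gradient_has_vector_derivative_along_trajectory[OF assms(1-3), of r] that \<open>0 \<le> s\<close>
    unfolding g_def has_vector_derivative_def by (auto intro: has_derivative_subset)
  have "((\<lambda>r. g r \<bullet> g r) has_derivative
      (\<lambda>h. 2 * h * (g r \<bullet> gradient_field c1 c2 p1 p2 (g r)))) (at r within {s..t})"
    if "r \<in> {s..t}" for r
    by (rule has_derivative_eq_rhs[OF has_derivative_inner[OF g'[OF that] g'[OF that]]])
       (auto simp: inner_commute)
  then obtain r where
    "g t \<bullet> g t - g s \<bullet> g s = 2 * (t - s) * (g r \<bullet> gradient_field c1 c2 p1 p2 (g r))"
    using mvt_very_simple[OF \<open>s \<le> t\<close>, of "\<lambda>r. g r \<bullet> g r"
        "\<lambda>r h. 2 * h * (g r \<bullet> gradient_field c1 c2 p1 p2 (g r))"]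
    by fastforce
  moreover have "g r \<bullet> gradient_field c1 c2 p1 p2 (g r) \<le> 0"
    using par by (simp add: inner_gradient_field)
  ultimately have "g t \<bullet> g t \<le> g s \<bullet> g s"
    using \<open>s \<le> t\<close> mult_nonneg_nonpos[of "2 * (t - s)"] by fastforce
  then show ?thesis
    by (simp add: g_def norm_le)
qed

lemma norm_gradient_has_derivative_along_trajectory:
  fixes f :: "real ^ 'n \<Rightarrow> real"
  assumes "C2 f" and "\<And>x. positive_definite (hessian f x)"
    and "trajectory (newton_field f c1 c2 p1 p2) x"
    and par: "1 < p1" "1 < p2" and "0 \<le> t" and "gradient f (x t) \<noteq> 0"
  shows "((\<lambda>t. norm (gradient f (x t))) has_real_derivative
      - (c1 * norm (gradient f (x t)) powr (1 / (p1 - 1)) +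
         c2 * norm (gradient f (x t)) powr (1 / (p2 - 1)))) (at t within {0..})"
proof -
  define g where "g = gradient f (x t)"
  have "((\<lambda>t. norm (gradient f (x t))) has_derivative
      (\<lambda>h. (h *\<^sub>R gradient_field c1 c2 p1 p2 g) \<bullet> sgn g)) (at t within {0..})"
    using has_derivative_compose[OF
        gradient_has_vector_derivative_along_trajectory[OF assms(1-3) \<open>0 \<le> t\<close>,
          unfolded has_vector_derivative_def]
        has_derivative_norm] assms(7)
    unfolding g_def by (auto simp: inner_commute)
  moreover have "(h *\<^sub>R gradient_field c1 c2 p1 p2 g) \<bullet> sgn g =
      - (c1 * norm g powr (1 / (p1 - 1)) + c2 * norm g powr (1 / (p2 - 1))) * h" for h
  proof -
    have "(h *\<^sub>R gradient_field c1 c2 p1 p2 g) \<bullet> sgn g =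
        h * ((g \<bullet> gradient_field c1 c2 p1 p2 g) / norm g)"
      by (simp add: sgn_div_norm inner_commute divide_inverse)
    also have "(g \<bullet> gradient_field c1 c2 p1 p2 g) / norm g =
        - (c1 * norm g powr (1 / (p1 - 1)) + c2 * norm g powr (1 / (p2 - 1)))"
      using assms(7) by (simp add: inner_gradient_field[OF par] g_def)
    finally show ?thesis
      by simp
  qed
  ultimately show ?thesis
    unfolding has_field_derivative_def g_def by (rule has_derivative_eq_rhs[OF _ ext])
qed

section \<open>Fixed-time convergence\<close>

theorem theorem3:
  fixes f :: "real ^ 'n \<Rightarrow> real" and xstar :: "real ^ 'n"
    and c1 c2 p1 p2 :: real
  assumes "C2 f"
    and "strictly_convex f"
    and "\<forall>x. positive_definite (hessian f x)"
    and "\<forall>y. f xstar \<le> f y"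
    and "c1 > 0" and "c2 > 0"
    and "p1 > 2" and "1 < p2" and "p2 < 2"
  shows "\<exists>T\<ge>0. \<forall>x. trajectory (newton_field f c1 c2 p1 p2) x \<longrightarrow> (\<forall>t\<ge>T. x t = xstar)"
proof -
  define \<gamma> \<delta> where "\<gamma> = 1 / (p1 - 1)" and "\<delta> = 1 / (p2 - 1)"
  have exps: "\<gamma> < 1" "1 < \<delta>"
    using assms by (simp_all add: \<gamma>_def \<delta>_def)
  define T where "T = 1 / (c2 * (\<delta> - 1)) + 1 / (c1 * (1 - \<gamma>))"
  have "0 \<le> T"
    using assms exps by (simp add: T_def)
  note pd = assms(3)[rule_format]
  have "x t = xstar" if x: "trajectory (newton_field f c1 c2 p1 p2) x" and "T \<le> t" for x t
  proof -
    define N where "N = (\<lambda>s. norm (gradient f (x s)))"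
    have "gradient f (x t) = 0"
    proof (rule ccontr)
      assume "gradient f (x t) \<noteq> 0"
      then have pos: "0 < N s" if "s \<in> {0..t}" for s
        using norm_gradient_antimono[OF \<open>C2 f\<close> pd x, of s t] assms that
        by (force simp: N_def)
      have "(N has_real_derivative - (c1 * N s powr \<gamma> + c2 * N s powr \<delta>)) (at s within {0..t})"
        if "s \<in> {0..t}" for s
        using norm_gradient_has_derivative_along_trajectory[OF \<open>C2 f\<close> pd x, of s] pos[OF that]
          assms that
        unfolding N_def \<gamma>_def \<delta>_def by (auto intro: DERIV_subset)
      from fixed_time_bound[OF \<open>c1 > 0\<close> \<open>c2 > 0\<close> exps pos this order_refl]
      show False
        using \<open>T \<le> t\<close> by (simp add: T_def)
    qed
    then show ?thesis
      using gradient_inj[OF \<open>C2 f\<close> pd] gradient_minimum[OF \<open>C2 f\<close>] assms(4) by metis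
  qed
  then show ?thesis
    using \<open>0 \<le> T\<close> by blast
qed

end
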